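(* For every $d \in \{2,3,4,5,8,12,16\}$, there are at most finitely many positive integers $n$ for which $\left\lfloor n^2/d \right\rfloor$ is prime. *)

theory Defs
  imports "HOL-Computational_Algebra.Primes"
begin

end

theory Submission
  imports Defs
begin

text \<open>The listed \<open>d\<close> have the property that every quadratic residue modulo \<open>d\<close>, reduced to
  \<open>{0..<d}\<close>, is a perfect square \<open>s\<^sup>2\<close>. If \<open>p = \<lfloor>n\<^sup>2/d\<rfloor>\<close>, this gives
  \<open>d p = n\<^sup>2 - s\<^sup>2 = (n - s)(n + s)\<close>, so a prime \<open>p\<close> divides \<open>n - s\<close> or \<open>n + s\<close> and is therefore
  at most linear in \<open>n\<close>, which bounds \<open>n\<close>.\<close>

lemma less_if_prime_square_div:
  fixes d n s :: nat
  assumes "d > 0" and s: "n\<^sup>2 mod d = s\<^sup>2" and p: "prime (n\<^sup>2 div d)"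
  shows "n < 2 * d"
proof (rule ccontr)
  assume "\<not> n < 2 * d"
  then have n: "2 * d \<le> n" by simp
  define m where "m = n\<^sup>2 div d"
  have eq: "d * m + s\<^sup>2 = n\<^sup>2"
    unfolding m_def s[symmetric] by simp
  have "s\<^sup>2 < d"
    using s \<open>d > 0\<close> by (metis mod_less_divisor)
  moreover have "s \<le> s\<^sup>2"
    by (simp add: power2_eq_square)
  ultimately have "s < d" by simp
  obtain k where "n = s + k"
    using \<open>s < d\<close> n by (metis le_add_diff_inverse le_trans less_imp_le_nat mult_2 le_add1)
  then have "n\<^sup>2 - s\<^sup>2 = (n - s) * (n + s)"
    by (simp add: power2_eq_square algebra_simps)
  then have "d * m = (n - s) * (n + s)"
    using eq by simp
  then have "m dvd (n - s) * (n + s)"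
    by (metis dvd_triv_right)
  then have "m dvd n - s \<or> m dvd n + s"
    using p by (simp add: m_def prime_dvd_mult_iff)
  \<comment> \<open>Both factors are positive because \<open>s < d < n\<close>, so divisibility
    bounds \<open>m\<close> by the larger one.\<close>
  then have "m \<le> n + s"
    using \<open>s < d\<close> n by (auto dest!: dvd_imp_le)
  then have "m + 1 \<le> 2 * n"
    using \<open>s < d\<close> n by simp
  \<comment> \<open>The \<open>+ 1\<close> absorbs the remainder \<open>s\<^sup>2 < d\<close>; this
    strict step makes the chain end in \<open>n\<^sup>2 < n\<^sup>2\<close>.\<close>
  have "n\<^sup>2 < d * (m + 1)"
    using eq \<open>s\<^sup>2 < d\<close> by simp
  also have "\<dots> \<le> d * (2 * n)"
    using \<open>m + 1 \<le> 2 * n\<close> by (rule mult_le_mono2)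
  also have "\<dots> \<le> n\<^sup>2"
    using mult_le_mono1[OF n, of n] by (simp add: power2_eq_square mult.assoc mult.left_commute)
  finally show False by simp
qed

text \<open>A finite check suffices, as \<open>n\<^sup>2 mod d\<close> depends only on
  \<open>n mod d\<close>.\<close>

lemma square_mod_eq_square:
  fixes d n :: nat
  assumes "d \<in> {2,3,4,5,8,12,16}"
  shows "\<exists>s. n\<^sup>2 mod d = s\<^sup>2"
proof -
  \<comment> \<open>Remainders are below 16, so only the squares of 0 to 3 can occur.\<close>
  have "\<forall>d\<in>{2,3,4,5,8,12,16}. \<forall>r\<in>{..<d}. r\<^sup>2 mod d \<in> {0\<^sup>2, 1\<^sup>2, 2\<^sup>2, (3::nat)\<^sup>2}"
    by (simp add: lessThan_nat_numeral lessThan_Suc)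
  moreover have "n mod d < d"
    using assms by auto
  ultimately have "(n mod d)\<^sup>2 mod d \<in> {0\<^sup>2, 1\<^sup>2, 2\<^sup>2, 3\<^sup>2}"
    using assms by blast
  then show ?thesis
    unfolding power_mod by blast
qed

theorem theorem1:
  fixes d :: nat
  assumes "d \<in> {2,3,4,5,8,12,16}"
  shows "finite {n :: nat. n > 0 \<and> prime (n\<^sup>2 div d)}"
proof (rule finite_subset)
  have "d > 0" using assms by auto
  then show "{n :: nat. n > 0 \<and> prime (n\<^sup>2 div d)} \<subseteq> {..<2 * d}"
    using square_mod_eq_square[OF assms] less_if_prime_square_div by blast
qed simp

end
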